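(* Let $n,k$ be powers of $2$ with $2\le k\le n/2$. Let $\bar l\in\mathbb N^{n/2}$ be top $k$ sorted, let $\bar r\in\mathbb N^{n/2}$ be top $k/2$ sorted, and assume $l_i\ge r_i$ for all $1\le i\le k/2$. Apply the network $pw\_bit\_merge^n_k$ to $\bar l::\bar r$: (1) compute $\bar y=bit\_split^k(l_{k/2+1},\dots,l_k,r_1,\dots,r_{k/2})$ and let $\bar b=\langle l_1,\dots,l_{k/2}\rangle::\langle y_1,\dots,y_{k/2}\rangle$; (2) compute $bit\_merge^k(\bar b)$. Then the output of step (2) is sorted and coincides with the first $k$ entries of the nonincreasing rearrangement of $\bar l::\bar r$ (it consists of the $k$ largest elements of $\bar l::\bar r$ in sorted order).
   Context: A sequence is sorted if it is nonincreasing; $::$ is concatenation. For sequences $\bar x,\bar y$, $\bar x\succeq\bar y$ means every entry of $\bar x$ is $\ge$ every entry of $\bar y$. $\bar x\in\mathbb N^m$ is top $k$ sorted if $\langle x_1,\dots,x_k\rangle$ is sorted and $\langle x_1,\dots,x_k\rangle\succeq\langle x_{k+1},\dots,x_m\rangle$. A comparator $c_{i,j}$ ($i<j$) puts the maximum of the entries at positions $i,j$ into position $i$ and the minimum into position $j$. For $m$ even, $split^m$ applies $c_{i,m/2+i}$ ($i=1,\dots,m/2$) and $bit\_split^m$ applies $c_{i,m-i+1}$ ($i=1,\dots,m/2$). For $m$ a power of 2, $bit\_merge^m$ (Batcher's bitonic merger) is: $c_{1,2}$ if $m=2$; otherwise $split^m$ followed by $bit\_merge^{m/2}$ on the left half and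 on the right half. *)

theory Defs
  imports Main
begin

text \<open>Sequences are lists with 0-based positions, so the entry \<open>x\<^sub>i\<close> of a sequence is
  \<open>xs ! (i - 1)\<close>.  ``Sorted'' means nonincreasing throughout.\<close>

definition desc_sorted :: "nat list \<Rightarrow> bool" where
  "desc_sorted xs \<longleftrightarrow> sorted_wrt (\<ge>) xs"

definition dominates :: "nat list \<Rightarrow> nat list \<Rightarrow> bool" where
  "dominates xs ys \<longleftrightarrow> (\<forall>x\<in>set xs. \<forall>y\<in>set ys. x \<ge> y)"

definition top_sorted :: "nat \<Rightarrow> nat list \<Rightarrow> bool" where
  "top_sorted k xs \<longleftrightarrow> desc_sorted (take k xs) \<and> dominates (take k xs) (drop k xs)"

definition comparator :: "nat \<Rightarrow> nat \<Rightarrow> nat list \<Rightarrow> nat list" where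
  "comparator i j xs = xs[i := max (xs ! i) (xs ! j), j := min (xs ! i) (xs ! j)]"

definition split_net :: "nat \<Rightarrow> nat list \<Rightarrow> nat list" where
  "split_net m = fold (\<lambda>i. comparator i (m div 2 + i)) [0..<m div 2]"

text \<open>With 1-based positions the comparators below are \<open>c\<^bsub>i,m-i+1\<^esub>\<close> for
  \<open>1 \<le> i \<le> m/2\<close>.\<close>

definition bit_split :: "nat \<Rightarrow> nat list \<Rightarrow> nat list" where
  "bit_split m = fold (\<lambda>i. comparator i (m - 1 - i)) [0..<m div 2]"

text \<open>Only powers of two \<open>m \<ge> 2\<close> are meaningful; the case \<open>m < 2\<close> merely makes the
  function total and is never reached from such an \<open>m\<close>.\<close>

fun bit_merge :: "nat \<Rightarrow> nat list \<Rightarrow> nat list" where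
  "bit_merge m xs =
    (if m < 2 then xs
     else if m = 2 then comparator 0 1 xs
     else (let ys = split_net m xs
           in bit_merge (m div 2) (take (m div 2) ys) @ bit_merge (m div 2) (drop (m div 2) ys)))"

declare bit_merge.simps [simp del]

text \<open>The input is the concatenation of two sequences of length \<open>n/2\<close>; the result consists of
  the \<open>k\<close> outputs of the final bitonic merger.\<close>

definition pw_bit_merge :: "nat \<Rightarrow> nat \<Rightarrow> nat list \<Rightarrow> nat list" where
  "pw_bit_merge n k xs =
    (let l = take (n div 2) xs;
         r = drop (n div 2) xs;
         y = bit_split k (drop (k div 2) (take k l) @ take (k div 2) r);
         b = take (k div 2) l @ take (k div 2) y
     in bit_merge k b)"

end

theory Submission
  imports Defs "HOL-Library.Multiset"
begin

text \<open>By monotonicity, the merger commutes with every threshold map \<open>x \<mapsto> [c \<le> x]\<close>, so its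
  behaviour can be read off from 0-1 sequences. A bitonic 0-1 sequence of length \<open>m\<close> has the form
  \<open>[(i + s) mod m < t]\<close>; one split turns it into \<open>[(i + s) mod (m/2) < t]\<close> and
  \<open>[(i + s) mod (m/2) < t - m/2]\<close>, and by induction the output is \<open>[i < t]\<close>. Under any threshold
  the sequence \<open>b\<close> of the theorem becomes ones, then zeros, then ones, hence is bitonic. Finally
  every entry of \<open>b\<close> is at least every discarded entry, so \<open>b\<close> holds the \<open>k\<close> largest ones.\<close>

section \<open>Comparator layers as entrywise maxima and minima\<close>

lemma length_comparator [simp]: "length (comparator i j xs) = length xs"
  by (simp add: comparator_def)

lemma length_fold_comparator [simp]:
  "length (fold (\<lambda>i. comparator i (f i)) is xs) = length xs"
  by (induction "is" arbitrary: xs) auto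

text \<open>The pairs \<open>{i, f i}\<close> are disjoint, because \<open>f\<close> is injective
  and maps into positions from \<open>h\<close> on. Hence every comparator still sees original
  entries and the layer acts simultaneously. The number \<open>j\<close> of comparators executed so
  far is there for the induction.\<close>

lemma fold_comparator_nth:
  assumes "h \<le> length xs" "\<And>i. i < h \<Longrightarrow> h \<le> f i \<and> f i < length xs" "inj_on f {..<h}"
    and "j \<le> h" "i < h"
  defines "ys \<equiv> fold (\<lambda>i. comparator i (f i)) [0..<j] xs"
  shows "ys ! i = (if i < j then max (xs ! i) (xs ! f i) else xs ! i)"
    and "ys ! f i = (if i < j then min (xs ! i) (xs ! f i) else xs ! f i)"
proof -
  have "(ys ! i = (if i < j then max (xs ! i) (xs ! f i) else xs ! i)) \<and>
        (ys ! f i = (if i < j then min (xs ! i) (xs ! f i) else xs ! f i))"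
    using assms(4,5) unfolding ys_def
  proof (induction j arbitrary: i)
    case (Suc j)
    let ?ys = "fold (\<lambda>i. comparator i (f i)) [0..<j] xs"
    have f: "h \<le> f i" "f i < length xs" "h \<le> f j" "f j < length xs"
      using assms(2)[of i] assms(2)[of j] Suc.prems by auto
    have lt: "i < length ?ys" "j < length ?ys" "f i < length ?ys" "f j < length ?ys"
      using f Suc.prems assms(1) by simp_all
    have ne: "i \<noteq> f j" "f i \<noteq> j" using f Suc.prems by simp_all
    have step: "fold (\<lambda>i. comparator i (f i)) [0..<Suc j] xs = comparator j (f j) ?ys" by simp
    show ?case
    proof (cases "i = j")
      case True
      then show ?thesis unfolding step using Suc.IH[of j] Suc.prems lt ne
        by (simp add: comparator_def[of j "f j"])
    next
      case False
      then have "f i \<noteq> f j" using assms(3) Suc.prems by (auto simp: inj_on_def)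
      moreover have "i < Suc j \<longleftrightarrow> i < j" using False by auto
      ultimately show ?thesis unfolding step using Suc.IH[of i] Suc.prems lt ne False
        by (simp add: comparator_def[of j "f j"])
    qed
  qed simp
  then show "ys ! i = (if i < j then max (xs ! i) (xs ! f i) else xs ! i)"
    and "ys ! f i = (if i < j then min (xs ! i) (xs ! f i) else xs ! f i)" by simp_all
qed

lemma split_net_append:
  assumes "length u = h" "length v = h"
  shows "split_net (2 * h) (u @ v) = map2 max u v @ map2 min u v"
proof (rule nth_equalityI)
  note nths = fold_comparator_nth[where f = "\<lambda>i. h + i" and j = h and h = h and xs = "u @ v"]
  fix p assume "p < length (split_net (2 * h) (u @ v))"
  then have p: "p < 2 * h" using assms by (simp add: split_net_def)
  show "split_net (2 * h) (u @ v) ! p = (map2 max u v @ map2 min u v) ! p"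
  proof (cases "p < h")
    case True
    then show ?thesis using nths(1)[where i = p] assms by (simp add: split_net_def nth_append)
  next
    case False
    then show ?thesis using nths(2)[where i = "p - h"] assms p by (simp add: split_net_def nth_append)
  qed
qed (use assms in \<open>simp add: split_net_def\<close>)

text \<open>The partner \<open>2 * h - 1 - i\<close> of \<open>i\<close> is position
  \<open>h - 1 - i\<close> of \<open>v\<close>, that is, position \<open>i\<close> of
  \<open>rev v\<close>. The minima land at these mirrored places, so they appear reversed.\<close>

lemma bit_split_append:
  assumes "length u = h" "length v = h"
  shows "bit_split (2 * h) (u @ v) = map2 max u (rev v) @ rev (map2 min u (rev v))"
proof (rule nth_equalityI)
  have "inj_on (\<lambda>i. 2 * h - 1 - i) {..<h}" by (auto simp: inj_on_def)
  moreover have "h \<le> 2 * h - 1 - i \<and> 2 * h - 1 - i < length (u @ v)" if "i < h" for i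
    using that assms by auto
  moreover have "h \<le> length (u @ v)" using assms by simp
  ultimately have
    max: "bit_split (2 * h) (u @ v) ! i = max ((u @ v) ! i) ((u @ v) ! (2 * h - 1 - i))" and
    min: "bit_split (2 * h) (u @ v) ! (2 * h - 1 - i) = min ((u @ v) ! i) ((u @ v) ! (2 * h - 1 - i))"
    if "i < h" for i
    using fold_comparator_nth[where f = "\<lambda>i. 2 * h - 1 - i" and j = h and h = h and i = i
        and xs = "u @ v"] that by (simp_all add: bit_split_def)
  have nth: "(u @ v) ! i = u ! i" "(u @ v) ! (2 * h - 1 - i) = v ! (h - 1 - i)" if "i < h" for i
  proof -
    have "2 * h - 1 - i = h + (h - 1 - i)" using that by simp
    then show "(u @ v) ! (2 * h - 1 - i) = v ! (h - 1 - i)"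
      using nth_append_length_plus[of u v "h - 1 - i"] assms(1) by (simp only:)
    show "(u @ v) ! i = u ! i" using that assms by (simp add: nth_append)
  qed
  fix p assume "p < length (bit_split (2 * h) (u @ v))"
  then have p: "p < 2 * h" using assms by (simp add: bit_split_def)
  show "bit_split (2 * h) (u @ v) ! p = (map2 max u (rev v) @ rev (map2 min u (rev v))) ! p"
  proof (cases "p < h")
    case True
    then show ?thesis using max[of p] nth[of p] assms by (simp add: nth_append rev_nth)
  next
    case False
    \<comment> \<open>Position \<open>p\<close> of the right half is written by the comparator with
      index \<open>q\<close>, its mirror image.\<close>
    define q where "q = 2 * h - 1 - p"
    have q: "q < h" "p = 2 * h - 1 - q" "h - Suc (p - h) = q" using p False by (auto simp: q_def)
    have "bit_split (2 * h) (u @ v) ! p = min (u ! q) (v ! (h - 1 - q))"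
      using min[OF q(1)] nth[OF q(1)] q(2) by simp
    moreover have "(map2 max u (rev v) @ rev (map2 min u (rev v))) ! p = min (u ! q) (v ! (h - 1 - q))"
      using assms q(1,3) False p by (simp add: nth_append rev_nth)
    ultimately show ?thesis by simp
  qed
qed (use assms in \<open>simp add: bit_split_def\<close>)

section \<open>The merger: recursion, permutation and monotone maps\<close>

lemma bit_merge_1: "bit_merge (Suc 0) xs = xs"
  by (simp add: bit_merge.simps)

text \<open>The separate clause for length 2 also fits the pattern, since merging a single entry is
  the identity; this gives one uniform doubling rule.\<close>

lemma bit_merge_append:
  assumes "length u = h" "length v = h" "0 < h"
  shows "bit_merge (2 * h) (u @ v) = bit_merge h (map2 max u v) @ bit_merge h (map2 min u v)"
proof (cases "h = 1")
  case True
  then obtain x y where "u = [x]" "v = [y]" using assms by (auto simp: length_Suc_conv)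
  then show ?thesis using True bit_merge.simps[of 2]
    by (simp add: bit_merge_1 comparator_def)
next
  case False
  then show ?thesis using assms
    by (subst bit_merge.simps) (simp add: split_net_append Let_def)
qed

text \<open>Presents the list as two halves, ready for \<open>bit_merge_append\<close>. The
  induction hypothesis covers all lists of length \<open>2 ^ a\<close>, because it is applied to the
  maxima and minima rather than to \<open>u\<close> and \<open>v\<close>.\<close>

lemma double_length_induct [consumes 1, case_names 0 Suc]:
  assumes "length xs = 2 ^ a"
    and "\<And>xs. length xs = 1 \<Longrightarrow> P 0 xs"
    and "\<And>a u v. length u = 2 ^ a \<Longrightarrow> length v = 2 ^ a \<Longrightarrow>
           (\<And>xs. length xs = 2 ^ a \<Longrightarrow> P a xs) \<Longrightarrow> P (Suc a) (u @ v)"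
  shows "P a xs"
  using assms(1)
proof (induction a arbitrary: xs)
  case (Suc a)
  then show ?case using assms(3)[of "take (2 ^ a) xs" a "drop (2 ^ a) xs"] by simp
qed (use assms(2) in simp)

lemma mset_map2_max_min:
  fixes u v :: "'a::linorder list"
  assumes "length u = length v"
  shows "mset (map2 max u v) + mset (map2 min u v) = mset u + mset v"
  using assms by (induction u v rule: list_induct2) (auto simp: max_def min_def)

lemma mset_bit_merge: "length xs = 2 ^ a \<Longrightarrow> mset (bit_merge (2 ^ a) xs) = mset xs"
  by (induction rule: double_length_induct)
    (simp_all add: bit_merge_1 bit_merge_append mset_map2_max_min del: mset_map)

lemma length_bit_merge: "length xs = 2 ^ a \<Longrightarrow> length (bit_merge (2 ^ a) xs) = 2 ^ a"
  by (metis mset_bit_merge mset_eq_length)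

text \<open>Monotone maps commute with \<open>max\<close> and \<open>min\<close>, hence with every
  split.\<close>

lemma bit_merge_map:
  assumes "mono f" "length xs = 2 ^ a"
  shows "bit_merge (2 ^ a) (map f xs) = map f (bit_merge (2 ^ a) xs)"
  using assms(2)
proof (induction rule: double_length_induct)
  case (Suc a u v)
  have "map2 max (map f u) (map f v) = map f (map2 max u v)"
    "map2 min (map f u) (map f v) = map f (map2 min u v)"
    by (rule nth_equalityI; simp add: max_of_mono[OF assms(1)] min_of_mono[OF assms(1)])+
  then show ?case using Suc by (simp add: bit_merge_append del: map_map)
qed (simp add: bit_merge_1)

section \<open>Bitonic 0-1 sequences and the zero-one principle\<close>

lemma mod_double_cases:
  fixes x h :: nat
  assumes "0 < h"
  shows "x mod (2 * h) = x mod h \<and> (x + h) mod (2 * h) = x mod h + h \<or>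
         x mod (2 * h) = x mod h + h \<and> (x + h) mod (2 * h) = x mod h"
proof -
  define r where "r = x mod h"
  have r: "r < h" using assms by (simp add: r_def)
  have mod: "(2 * h * p + z) mod (2 * h) = z" if "z < 2 * h" for p z
    using that by simp
  have x: "x = h * (x div h) + r" by (simp add: r_def)
  show ?thesis
  \<comment> \<open>Adding \<open>h\<close> flips the parity of \<open>x div h\<close>, and this
    parity decides which of the two residues exceeds the other by \<open>h\<close>.\<close>
  proof (cases "even (x div h)")
    case True
    then obtain p where "x div h = 2 * p" by blast
    then have "x = 2 * h * p + r" "x + h = 2 * h * p + (r + h)" using x by simp_all
    then show ?thesis unfolding r_def[symmetric] using mod r
      by (metis add_strict_right_mono mult_2 trans_less_add1)
  next
    case False
    then obtain p where "x div h = 2 * p + 1" by (rule oddE)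
    then have "x = 2 * h * p + (r + h)" "x + h = 2 * h * Suc p + r" using x by simp_all
    then show ?thesis unfolding r_def[symmetric] using mod r
      by (metis add_strict_right_mono mult_2 trans_less_add1)
  qed
qed

text \<open>Entries compared by the split have residues \<open>r\<close> and \<open>r + h\<close> in
  some order. Their maximum tests \<open>r < t\<close>, their minimum \<open>r + h < t\<close>, so
  both halves keep the shift \<open>s\<close> and get thresholds \<open>t\<close> and
  \<open>t - h\<close>. Truncated subtraction gives the all-zero right half if
  \<open>t \<le> h\<close>; a \<open>t\<close> beyond the length means all ones.\<close>

lemma bit_merge_cyclic_threshold:
  "bit_merge (2 ^ a) (map (\<lambda>i. of_bool ((i + s) mod 2 ^ a < t)) [0..<2 ^ a]) =
   map (\<lambda>i. of_bool (i < t)) [0..<2 ^ a]"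
proof (induction a arbitrary: t)
  case (Suc a)
  define h :: nat where "h = 2 ^ a"
  have h: "0 < h" by (simp add: h_def)
  define g :: "nat \<Rightarrow> nat" where "g i = of_bool ((i + s) mod (2 * h) < t)" for i
  let ?u = "map g [0..<h]" and ?v = "map (\<lambda>i. g (i + h)) [0..<h]"
  have append: "map w [0..<2 * h] = map w [0..<h] @ map (\<lambda>i. w (i + h)) [0..<h]"
    for w :: "nat \<Rightarrow> nat"
    by (rule nth_equalityI) (auto simp: nth_append)
  have halves: "max (g i) (g (i + h)) = of_bool ((i + s) mod h < t)"
    "min (g i) (g (i + h)) = of_bool ((i + s) mod h < t - h)" for i
    using mod_double_cases[OF h, of "i + s"] by (auto simp: g_def ac_simps)
  have "map2 max ?u ?v = map (\<lambda>i. of_bool ((i + s) mod h < t)) [0..<h]"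
    "map2 min ?u ?v = map (\<lambda>i. of_bool ((i + s) mod h < t - h)) [0..<h]"
    by (rule nth_equalityI; simp add: halves)+
  then have "bit_merge (2 * h) (map g [0..<2 * h]) =
      map (\<lambda>i. of_bool (i < t)) [0..<h] @ map (\<lambda>i. of_bool (i < t - h)) [0..<h]"
    using h Suc.IH by (simp add: append bit_merge_append h_def[symmetric])
  also have "\<dots> = map (\<lambda>i. of_bool (i < t)) [0..<2 * h]"
    by (simp add: append less_diff_conv)
  finally show ?case by (simp add: g_def[abs_def] h_def)
qed (simp add: bit_merge_1)

lemma desc_sorted_threshold:
  assumes "desc_sorted xs"
  shows "\<exists>a\<le>length xs. \<forall>i<length xs. c \<le> xs ! i \<longleftrightarrow> i < a"
  using assms unfolding desc_sorted_def
proof (induction xs)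
  case (Cons x xs)
  then obtain a where a: "a \<le> length xs" "\<forall>i<length xs. c \<le> xs ! i \<longleftrightarrow> i < a" by auto
  show ?case
  proof (cases "c \<le> x")
    case True
    then show ?thesis using a by (intro exI[of _ "Suc a"]) (auto simp: less_Suc_eq_0_disj nth_Cons')
  next
    case False
    then have "\<forall>i<length (x # xs). \<not> c \<le> (x # xs) ! i"
      using Cons.prems by (fastforce simp: nth_Cons' dest: nth_mem)
    then show ?thesis by (intro exI[of _ 0]) auto
  qed
qed simp

text \<open>Bitonicity enters as: the entries reaching any threshold occupy a cyclic interval. To
  compare two output positions, the later entry itself serves as threshold; its 0-1 image is 1,
  which forces a 1 at the earlier position.\<close>

lemma desc_sorted_bit_merge:
  assumes len: "length xs = 2 ^ a"
    and cyc: "\<And>c. \<exists>s t. \<forall>i<2 ^ a. c \<le> xs ! i \<longleftrightarrow> (i + s) mod 2 ^ a < t"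
  shows "desc_sorted (bit_merge (2 ^ a) xs)"
  unfolding desc_sorted_def sorted_wrt_iff_nth_less
proof (intro allI impI)
  fix i j assume ij: "i < j" "j < length (bit_merge (2 ^ a) xs)"
  let ?out = "bit_merge (2 ^ a) xs" and ?c = "bit_merge (2 ^ a) xs ! j"
  define f :: "nat \<Rightarrow> nat" where "f x = of_bool (?c \<le> x)" for x
  have "mono f" by (rule monoI) (auto simp: f_def)
  obtain s t where st: "\<forall>i<2 ^ a. ?c \<le> xs ! i \<longleftrightarrow> (i + s) mod 2 ^ a < t" using cyc by blast
  have "map f xs = map (\<lambda>i. of_bool ((i + s) mod 2 ^ a < t)) [0..<2 ^ a]"
    using st len by (intro nth_equalityI) (auto simp: f_def)
  then have *: "map f ?out = map (\<lambda>i. of_bool (i < t)) [0..<2 ^ a]"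
    using bit_merge_map[OF \<open>mono f\<close> len] bit_merge_cyclic_threshold by simp
  have nth: "f (?out ! p) = of_bool (p < t)" if "p < 2 ^ a" for p
    using arg_cong[OF *, of "\<lambda>ys. ys ! p"] that by (simp add: length_bit_merge[OF len])
  have "j < 2 ^ a" using ij length_bit_merge[OF len] by simp
  then have "j < t" using nth[of j] by (simp add: f_def of_bool_def split: if_splits)
  then have "f (?out ! i) = 1" using nth[of i] ij \<open>j < 2 ^ a\<close> by simp
  then show "?c \<le> ?out ! i" by (simp add: f_def of_bool_def split: if_splits)
qed

text \<open>Entries of \<open>u @ v\<close> reaching \<open>c\<close> form a prefix of length
  \<open>p\<close>; those of \<open>w\<close> form a prefix of length \<open>q\<close>, which
  reversal moves to the last \<open>q\<close> positions. Prefix and suffix together are a cyclic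
  interval starting at \<open>2 * h - q\<close>, whence the shift \<open>q\<close> and the threshold
  \<open>p + q\<close>.\<close>

lemma cyclic_threshold_append_max:
  assumes len: "length u = h" "length v = h" "length w = h"
    and uv: "desc_sorted (u @ v)" and w: "desc_sorted w"
  shows "\<exists>s t. \<forall>i<2 * h. c \<le> (u @ map2 max v (rev w)) ! i \<longleftrightarrow> (i + s) mod (2 * h) < t"
proof -
  obtain p where p: "p \<le> 2 * h" "\<And>i. i < 2 * h \<Longrightarrow> c \<le> (u @ v) ! i \<longleftrightarrow> i < p"
    using desc_sorted_threshold[OF uv, of c] len unfolding length_append mult_2 by auto
  obtain q where q: "q \<le> h" "\<And>i. i < h \<Longrightarrow> c \<le> w ! i \<longleftrightarrow> i < q"
    using desc_sorted_threshold[OF w, of c] len by auto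
  have "c \<le> (u @ map2 max v (rev w)) ! i \<longleftrightarrow> (i + q) mod (2 * h) < p + q" if i: "i < 2 * h" for i
  proof -
    have "c \<le> (u @ map2 max v (rev w)) ! i \<longleftrightarrow> i < p \<or> 2 * h - q \<le> i"
    proof (cases "i < h")
      case True
      then show ?thesis using p(2)[of i] q(1) len by (auto simp: nth_append)
    next
      case False
      then have "(u @ map2 max v (rev w)) ! i = max ((u @ v) ! i) (w ! (2 * h - 1 - i))"
        using len i by (simp add: nth_append rev_nth mult_2)
      then show ?thesis using p(2)[of i] q(2)[of "2 * h - 1 - i"] q(1) i False
        by (auto simp: le_max_iff_disj)
    qed
    also have "\<dots> \<longleftrightarrow> (i + q) mod (2 * h) < p + q"
    \<comment> \<open>Without wrap-around \<open>q\<close> cancels on both sides; with it, the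
      residue is below \<open>q\<close> and \<open>i\<close> lies in the suffix.\<close>
    proof (cases "i + q < 2 * h")
      case False
      then have "(i + q) mod (2 * h) = i + q - 2 * h" using i q(1) by (simp add: le_mod_geq)
      then show ?thesis using False i by auto
    qed (use p q in auto)
    finally show ?thesis .
  qed
  then show ?thesis by blast
qed

section \<open>Selection of the largest entries\<close>

lemma take_rev_sort_eqI:
  assumes "mset zs = mset xs + mset ys" "desc_sorted xs" "dominates xs ys"
  shows "take (length xs) (rev (sort zs)) = xs"
proof -
  \<comment> \<open>An ascending arrangement of \<open>zs\<close> is unique, so this list is
    \<open>sort zs\<close>, and its reverse begins with \<open>xs\<close>.\<close>
  have "sorted (sort ys @ rev xs)"
    using assms(2,3) by (auto simp: sorted_append desc_sorted_def dominates_def sorted_wrt_rev)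
  then have "sort zs = sort ys @ rev xs"
    using assms(1) by (intro properties_for_sort) simp_all
  then show ?thesis by simp
qed

lemma desc_sorted_appendD:
  "desc_sorted (xs @ ys) \<Longrightarrow> desc_sorted xs \<and> desc_sorted ys \<and> dominates xs ys"
  by (auto simp: desc_sorted_def dominates_def sorted_wrt_append)

lemma dominates_append_rev:
  "dominates (xs @ ys) zs \<longleftrightarrow> dominates xs zs \<and> dominates ys zs"
  "dominates xs (ys @ zs) \<longleftrightarrow> dominates xs ys \<and> dominates xs zs"
  "dominates xs (rev ys) \<longleftrightarrow> dominates xs ys"
  by (auto simp: dominates_def)

text \<open>The minimum at \<open>j\<close> is bounded by the maximum at \<open>i\<close> through
  \<open>v\<close>, which descends, if \<open>i \<le> j\<close>, and through \<open>rev w\<close>,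
  which ascends, if \<open>j < i\<close>.\<close>

lemma dominates_map2_max_min:
  assumes "length v = length w" "desc_sorted v" "desc_sorted w"
  shows "dominates (map2 max v (rev w)) (map2 min v (rev w))"
proof -
  have desc: "xs ! j \<le> xs ! i" if "desc_sorted xs" "i \<le> j" "j < length xs" for xs i j
    using that by (cases "i = j") (auto simp: desc_sorted_def sorted_wrt_iff_nth_less)
  have "min (v ! j) (rev w ! j) \<le> max (v ! i) (rev w ! i)" if "i < length v" "j < length v" for i j
  proof (cases "i \<le> j")
    case True
    then show ?thesis using desc[of v i j] assms that by simp
  next
    case False
    then have "rev w ! j \<le> rev w ! i"
      using desc[of w "length w - Suc i" "length w - Suc j"] assms that by (simp add: rev_nth)
    then show ?thesis by simp
  qed
  then show ?thesis using assms(1) by (auto simp: dominates_def in_set_conv_nth)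
qed

lemma set_map2D:
  assumes "x \<in> set (map2 f v w)"
  obtains y z where "y \<in> set v" "z \<in> set w" "x = f y z"
  using assms by (auto dest: set_zip_leftD set_zip_rightD)

theorem theorem2:
  fixes n k :: nat and l r :: "nat list"
  assumes "\<exists>a. n = 2 ^ a"
    and "\<exists>a. k = 2 ^ a"
    and "2 \<le> k" and "k \<le> n div 2"
    and "length l = n div 2" and "length r = n div 2"
    and "top_sorted k l"
    and "top_sorted (k div 2) r"
    and "\<forall>i < k div 2. l ! i \<ge> r ! i"
  shows "desc_sorted (pw_bit_merge n k (l @ r)) \<and>
    pw_bit_merge n k (l @ r) = take k (rev (sort (l @ r)))"
proof -
  obtain a where a: "k = 2 ^ a" using assms(2) by blast
  define h where "h = k div 2"
  have "a \<noteq> 0" using a assms(3) by (intro notI) simp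
  then have k: "k = 2 * h" using a by (cases a) (auto simp: h_def)
  \<comment> \<open>The block \<open>u\<close> goes straight to the merger, \<open>v\<close> and
    \<open>w\<close> pass through \<open>bit_split\<close>, and the tails \<open>x\<close> and
    \<open>y\<close> are discarded.\<close>
  define u v x where "u = take h l" and "v = drop h (take k l)" and "x = drop k l"
  define w y where "w = take h r" and "y = drop h r"
  have l: "l = (u @ v) @ x"
  proof -
    have "u @ v = take k l"
      using append_take_drop_id[of h "take k l"] k by (simp add: u_def v_def min_def)
    then show ?thesis by (simp add: x_def)
  qed
  have r: "r = w @ y" by (simp add: w_def y_def)
  have len: "length u = h" "length v = h" "length w = h"
    using assms(4-6) k by (simp_all add: u_def v_def w_def)
  have uv: "desc_sorted (u @ v)" "dominates (u @ v) x"
    using assms(7) k len unfolding top_sorted_def l by simp_all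
  have wy: "desc_sorted w" "dominates w y"
    using assms(8) len unfolding top_sorted_def h_def[symmetric] r by simp_all
  note u_v = desc_sorted_appendD[OF uv(1)]
  have uw: "w ! i \<le> u ! i" if "i < h" for i
    using assms(9) that len unfolding h_def[symmetric] l r by (auto simp: nth_append)
  \<comment> \<open>\<open>b\<close> is the input of the merger and \<open>d\<close> collects all
    that is discarded; it remains to see that \<open>b\<close> dominates \<open>d\<close>.\<close>
  define b d where "b = u @ map2 max v (rev w)" and "d = rev (map2 min v (rev w)) @ x @ y"
  have out: "pw_bit_merge n k (l @ r) = bit_merge k b"
  proof -
    have "take (n div 2) (l @ r) = l" "drop (n div 2) (l @ r) = r" using assms(5) by simp_all
    then have "pw_bit_merge n k (l @ r) = bit_merge k (u @ take h (bit_split (2 * h) (v @ w)))"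
      by (simp add: pw_bit_merge_def Let_def h_def[symmetric] u_def v_def w_def k)
    then show ?thesis using len by (simp add: bit_split_append b_def)
  qed
  have lenb: "length b = 2 ^ a" using len k a by (simp add: b_def)
  have sorted: "desc_sorted (bit_merge k b)"
    unfolding a using lenb cyclic_threshold_append_max[OF len uv(1) wy(1)] a k
    by (intro desc_sorted_bit_merge) (simp_all add: b_def)
  have mset: "mset (bit_merge k b) = mset b"
    unfolding a using lenb by (rule mset_bit_merge)
  have "mset (l @ r) = mset b + mset d"
  proof -
    have "mset b + mset d =
        mset u + (mset (map2 max v (rev w)) + mset (map2 min v (rev w))) + mset x + mset y"
      by (simp add: b_def d_def del: mset_map)
    also have "\<dots> = mset (l @ r)"
      using len by (subst mset_map2_max_min) (simp_all add: l r)
    finally show ?thesis by simp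
  qed
  then have "mset (l @ r) = mset (bit_merge k b) + mset d" by (simp only: mset)
  moreover have "dominates b d"
  proof -
    \<comment> \<open>Each minimum is at most an entry of \<open>v\<close>, which \<open>u\<close>
      dominates.\<close>
    have 1: "dominates u (map2 min v (rev w))"
      using u_v unfolding dominates_def
      by (intro ballI, elim set_map2D) (auto simp: min_le_iff_disj)
    \<comment> \<open>Here the hypothesis linking \<open>l\<close> and \<open>r\<close> enters:
      \<open>u ! i\<close> is at least \<open>w ! i\<close>, which is at least every entry of
      \<open>y\<close>.\<close>
    have 2: "dominates u y"
      unfolding dominates_def
    proof (intro ballI)
      fix p q assume "p \<in> set u" "q \<in> set y"
      then obtain i where i: "i < h" "p = u ! i" using len by (auto simp: in_set_conv_nth)
      have "w ! i \<in> set w" using i(1) len by simp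
      then have "q \<le> w ! i" using wy(2) \<open>q \<in> set y\<close> by (simp add: dominates_def)
      also have "\<dots> \<le> p" using uw i by simp
      finally show "q \<le> p" .
    qed
    \<comment> \<open>A maximum is bounded below by its entry from \<open>v\<close> against
      \<open>x\<close>, and by its entry from \<open>w\<close> against \<open>y\<close>.\<close>
    have 3: "dominates (map2 max v (rev w)) x"
      using uv(2) unfolding dominates_def
      by (intro ballI, elim set_map2D) (auto simp: le_max_iff_disj)
    have 4: "dominates (map2 max v (rev w)) y"
      using wy(2) unfolding dominates_def
      by (intro ballI, elim set_map2D) (auto simp: le_max_iff_disj)
    have 5: "dominates (map2 max v (rev w)) (map2 min v (rev w))"
      using dominates_map2_max_min u_v wy(1) len by simp
    have 6: "dominates u x" using uv(2) by (simp add: dominates_def)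
    show ?thesis using 1 2 3 4 5 6 unfolding b_def d_def by (simp only: dominates_append_rev)
  qed
  \<comment> \<open>Domination depends only on the set of entries, which merging preserves.\<close>
  then have "dominates (bit_merge k b) d"
    using mset_eq_setD[OF mset] by (simp add: dominates_def)
  ultimately have "take (length (bit_merge k b)) (rev (sort (l @ r))) = bit_merge k b"
    using sorted by (intro take_rev_sort_eqI)
  then show ?thesis using sorted out lenb a by (simp add: length_bit_merge)
qed

end
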